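(* Let $X$ be a complex Banach space, let $\mathcal{U}=\{U(t,s)\}_{t\ge s\ge 0}$ be a nonuniform exponentially bounded evolution family on $X$, and let $\alpha\in\mathcal{A}(\mathcal{U})$ be such that $$\sigma_{ap}(G_{\mathcal{U},\alpha})\cap i\mathbb{R}\neq i\mathbb{R}.$$ Then there exist a constant $\nu>0$ and a continuous function $N:\mathbb{R}_+\to(0,\infty)$ such that for every $x_0\in X$ and every $t_0\ge 0$ with $\sup_{t\ge t_0}\|U(t,t_0)x_0\|<\infty$ one has $$\|U(t,t_0)x_0\|\le N(t_0)e^{-\nu(t-t_0)}\|x_0\|\qquad\text{for all } t\ge t_0.$$
   Context: $\mathbb{R}_+=[0,\infty)$, and $C(\mathbb{R}_+,X)$ is the space of all continuous functions $\mathbb{R}_+\to X$. An evolution family (on the half-line) is a family $\mathcal{U}=\{U(t,s)\}_{t\ge s\ge 0}$ of bounded linear operators on $X$ such that $U(t,t)=\mathrm{Id}$ for $t\ge 0$; $U(t,\tau)U(\tau,s)=U(t,s)$ for $t\ge\tau\ge s\ge 0$; and $(t,s)\mapsto U(t,s)x$ is continuous on $\{t\ge s\ge 0\}$ for every $x\in X$. A number $\alpha\in\mathbb{R}$ is an admissible exponent of $\mathcal{U}$ if there is a continuous map $M_\alpha:\mathbb{R}_+\to(0,\infty)$ with $\|U(t,s)\|\le M_\alpha(s)e^{\alpha(t-s)}$ for all $t\ge s\ge 0$. $\mathcal{A}(\mathcal{U})$ is the set of all admissible exponents, and $\mathcal{U}$ is nonuniform exponentially bounded if $\mathcal{A}(\mathcal{U})\ne\emptyset$.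 For $\alpha\in\mathcal{A}(\mathcal{U})$, $t\ge 0$ and $u\in C(\mathbb{R}_+,X)$, put $\varphi_{\mathcal{U},\alpha}(t,u)=\sup_{\tau\ge t}e^{-\alpha(\tau-t)}\|U(\tau,t)u(t)\|$. The admissible Banach function space is $$\mathcal{C}(\mathcal{U},\alpha)=\{u\in C(\mathbb{R}_+,X):\ \lim_{t\to\infty}\varphi_{\mathcal{U},\alpha}(t,u)=\|u(0)\|=0\},$$ which is a Banach space with the norm $\|u\|_{\mathcal{U},\alpha}=\sup_{t\ge 0}\varphi_{\mathcal{U},\alpha}(t,u)$. On it, the formula $(T_\alpha(t)u)(s)=U(s,s-t)u(s-t)$ if $s>t$, and $(T_\alpha(t)u)(s)=0$ if $0\le s\le t$, defines a $C_0$-semigroup $\mathcal{T}_\alpha=\{T_\alpha(t)\}_{t\ge 0}$; its infinitesimal generator is denoted $G_{\mathcal{U},\alpha}$ (i.e. $G_{\mathcal{U},\alpha}u=\lim_{t\to 0_+}\frac{T_\alpha(t)u-u}{t}$, with domain the set of $u$ for which this limit exists in $\mathcal{C}(\mathcal{U},\alpha)$). The approximate point spectrum of a linear operator $G:D(G)\subset E\to E$ on a Banach space $E$ is $$\sigma_{ap}(G)=\{\lambda\in\mathbb{C}:\ \forall\,\varepsilon>0\ \exists\,x\in D(G),\ \|x\|=1,\ \text{with } \|\lambda x-Gx\|\le\varepsilon\}.$$ *)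

theory Defs
  imports "HOL-Analysis.Analysis"
begin

text \<open>The distribution has no class of complex normed spaces. A complex Banach space is a
  real Banach space with a compatible complex scalar multiplication; \<open>scaleC 1 x = x\<close> follows
  from \<open>scaleR_scaleC\<close>.\<close>

class complex_banach = banach +
  fixes scaleC :: "complex \<Rightarrow> 'a \<Rightarrow> 'a"  (infixr \<open>*\<^sub>C\<close> 75)
  assumes scaleC_add_right: "a *\<^sub>C (x + y) = a *\<^sub>C x + a *\<^sub>C y"
    and scaleC_add_left: "(a + b) *\<^sub>C x = a *\<^sub>C x + b *\<^sub>C x"
    and scaleC_scaleC: "a *\<^sub>C (b *\<^sub>C x) = (a * b) *\<^sub>C x"
    and scaleR_scaleC: "r *\<^sub>R x = complex_of_real r *\<^sub>C x"
    and norm_scaleC: "norm (a *\<^sub>C x) = cmod a * norm x"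

instantiation complex :: complex_banach
begin

definition scaleC_complex :: "complex \<Rightarrow> complex \<Rightarrow> complex" where
  "scaleC_complex a x = a * x"

instance
  by standard (simp_all add: scaleC_complex_def algebra_simps norm_mult scaleR_conv_of_real)

end

definition bounded_clinear :: "('a::complex_banach \<Rightarrow> 'a) \<Rightarrow> bool" where
  "bounded_clinear f \<longleftrightarrow> bounded_linear f \<and> (\<forall>a x. f (a *\<^sub>C x) = a *\<^sub>C f x)"

text \<open>Only the values \<open>U t s\<close> with \<open>t \<ge> s \<ge> 0\<close> are relevant.\<close>

definition evolution_family :: "(real \<Rightarrow> real \<Rightarrow> 'a::complex_banach \<Rightarrow> 'a) \<Rightarrow> bool" where
  "evolution_family U \<longleftrightarrow>
     (\<forall>t s. 0 \<le> s \<and> s \<le> t \<longrightarrow> bounded_clinear (U t s)) \<and>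
     (\<forall>t\<ge>0. \<forall>x. U t t x = x) \<and>
     (\<forall>t \<tau> s. 0 \<le> s \<and> s \<le> \<tau> \<and> \<tau> \<le> t \<longrightarrow> U t \<tau> \<circ> U \<tau> s = U t s) \<and>
     (\<forall>x. continuous_on {(t, s). 0 \<le> s \<and> s \<le> t} (\<lambda>(t, s). U t s x))"

definition admissible_exponents :: "(real \<Rightarrow> real \<Rightarrow> 'a::complex_banach \<Rightarrow> 'a) \<Rightarrow> real set" where
  "admissible_exponents U =
     {\<alpha>. \<exists>M :: real \<Rightarrow> real. continuous_on {0..} M \<and> (\<forall>s\<ge>0. M s > 0) \<and>
          (\<forall>t s. 0 \<le> s \<and> s \<le> t \<longrightarrow> onorm (U t s) \<le> M s * exp (\<alpha> * (t - s)))}"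

definition nonuniform_exp_bounded :: "(real \<Rightarrow> real \<Rightarrow> 'a::complex_banach \<Rightarrow> 'a) \<Rightarrow> bool" where
  "nonuniform_exp_bounded U \<longleftrightarrow> admissible_exponents U \<noteq> {}"

text \<open>The two suprema below are suprema of sets of reals; they are bounded above whenever
  \<open>\<alpha>\<close> is admissible and \<open>u\<close> belongs to \<open>adm_space U \<alpha>\<close>.\<close>

definition adm_phi ::
  "(real \<Rightarrow> real \<Rightarrow> 'a::complex_banach \<Rightarrow> 'a) \<Rightarrow> real \<Rightarrow> real \<Rightarrow> (real \<Rightarrow> 'a) \<Rightarrow> real" where
  "adm_phi U \<alpha> t u = (SUP \<tau>\<in>{t..}. exp (- \<alpha> * (\<tau> - t)) * norm (U \<tau> t (u t)))"

definition adm_norm ::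
  "(real \<Rightarrow> real \<Rightarrow> 'a::complex_banach \<Rightarrow> 'a) \<Rightarrow> real \<Rightarrow> (real \<Rightarrow> 'a) \<Rightarrow> real" where
  "adm_norm U \<alpha> u = (SUP t\<in>{0..}. adm_phi U \<alpha> t u)"

text \<open>A function on \<open>[0, \<infinity>)\<close> is represented by its extension by \<open>0\<close> to the negative reals,
  so that each element of the space has exactly one representative.\<close>

definition adm_space ::
  "(real \<Rightarrow> real \<Rightarrow> 'a::complex_banach \<Rightarrow> 'a) \<Rightarrow> real \<Rightarrow> (real \<Rightarrow> 'a) set" where
  "adm_space U \<alpha> =
     {u. continuous_on {0..} u \<and> (\<forall>s<0. u s = 0) \<and>
         ((\<lambda>t. adm_phi U \<alpha> t u) \<longlongrightarrow> 0) at_top \<and> norm (u 0) = 0}"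

definition evol_semigroup ::
  "(real \<Rightarrow> real \<Rightarrow> 'a::complex_banach \<Rightarrow> 'a) \<Rightarrow> real \<Rightarrow> (real \<Rightarrow> 'a) \<Rightarrow> (real \<Rightarrow> 'a)" where
  "evol_semigroup U t u = (\<lambda>s. if s > t then U s (s - t) (u (s - t)) else 0)"

definition is_gen_value ::
  "(real \<Rightarrow> real \<Rightarrow> 'a::complex_banach \<Rightarrow> 'a) \<Rightarrow> real \<Rightarrow> (real \<Rightarrow> 'a) \<Rightarrow> (real \<Rightarrow> 'a) \<Rightarrow> bool" where
  "is_gen_value U \<alpha> u v \<longleftrightarrow> v \<in> adm_space U \<alpha> \<and>
     ((\<lambda>h. adm_norm U \<alpha> (\<lambda>s. (1 / h) *\<^sub>R (evol_semigroup U h u s - u s) - v s)) \<longlongrightarrow> 0) (at_right 0)"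

definition gen_domain ::
  "(real \<Rightarrow> real \<Rightarrow> 'a::complex_banach \<Rightarrow> 'a) \<Rightarrow> real \<Rightarrow> (real \<Rightarrow> 'a) set" where
  "gen_domain U \<alpha> = {u \<in> adm_space U \<alpha>. \<exists>v. is_gen_value U \<alpha> u v}"

definition evol_generator ::
  "(real \<Rightarrow> real \<Rightarrow> 'a::complex_banach \<Rightarrow> 'a) \<Rightarrow> real \<Rightarrow> (real \<Rightarrow> 'a) \<Rightarrow> (real \<Rightarrow> 'a)" where
  "evol_generator U \<alpha> u = (THE v. is_gen_value U \<alpha> u v)"

text \<open>Approximate point spectrum of an operator \<open>G\<close> with domain \<open>D\<close> in a space of
  \<open>'a\<close>-valued functions with norm \<open>nrm\<close> and pointwise operations.\<close>

definition approx_point_spectrum ::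
  "((real \<Rightarrow> 'a::complex_banach) \<Rightarrow> real) \<Rightarrow> (real \<Rightarrow> 'a) set \<Rightarrow>
   ((real \<Rightarrow> 'a) \<Rightarrow> (real \<Rightarrow> 'a)) \<Rightarrow> complex set" where
  "approx_point_spectrum nrm D G =
     {z. \<forall>\<epsilon>>0. \<exists>u\<in>D. nrm u = 1 \<and> nrm (\<lambda>s. z *\<^sub>C u s - G u s) \<le> \<epsilon>}"

definition imag_axis :: "complex set" where
  "imag_axis = range (\<lambda>\<omega>::real. \<i> * complex_of_real \<omega>)"

end

theory Submission
  imports Defs
begin

text \<open>
  If \<open>\<alpha> < 0\<close>, the admissibility bound itself is the conclusion, so let \<open>\<alpha> \<ge> 0\<close>. The norm of
  the function space is \<open>sup\<^sub>t |u(t)|\<^sub>t\<close> for the Lyapunov norms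
  \<open>|x|\<^sub>t = sup {exp(-\<alpha>(\<tau>-t)) \<parallel>U(\<tau>,t)x\<parallel> : \<tau> \<ge> t}\<close>, which lie between \<open>\<parallel>x\<parallel>\<close> and \<open>M(t)\<parallel>x\<parallel>\<close>; along
  an orbit they grow at most by the factor \<open>exp(\<alpha>)\<close> per unit of time. It is enough to make
  \<open>a(t) = |U(t,t0)x|\<^sub>t\<close> decay at a rate that depends neither on \<open>t0\<close> nor on \<open>x\<close>; the factor
  \<open>M(t0)\<close> then gives the nonuniform constant. Since \<open>\<alpha> \<ge> 0\<close>, \<open>a\<close> is bounded as soon as the
  orbit is bounded in norm.

  A point \<open>i\<omega>\<close> outside the approximate point spectrum means that \<open>c \<parallel>u\<parallel> \<le> \<parallel>i\<omega>u - Gu\<parallel>\<close> on the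
  domain of \<open>G\<close>, for some \<open>c > 0\<close>. On \<open>u(s) = f(s) U(s,t0)x\<close>, the evolution semigroup merely
  shifts the scalar factor \<open>f\<close>, so \<open>Gu = -f' U(s,t0)x\<close> (\<open>modulated_orbit_generator\<close>) and the
  estimate reads \<open>c sup |f| a \<le> sup |i\<omega>f + f'| a\<close> (\<open>resolvent_bound_modulated_orbit\<close>).

  The profile \<open>f(t0+x) = (1 - exp(-kx))\<^sup>2 exp(-(\<eta>+i\<omega>)x)\<close> starts with a double zero, which
  keeps \<open>u\<close> and \<open>Gu\<close> in the space, and its oscillation cancels \<open>i\<omega>\<close>, so that
  \<open>|i\<omega>f + f'| \<le> \<eta> + 2k exp(-kx)\<close>. The factor \<open>exp(-\<eta>x)\<close> only makes \<open>f\<close> vanish at infinity. As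
  \<open>a\<close> is bounded, letting \<open>\<eta>\<close> tend to \<open>0\<close> leaves
  \<open>c (1 - exp(-kx))\<^sup>2 a(t0+x) \<le> 2k sup {exp(-ky) a(t0+y) : y \<ge> 0}\<close> (\<open>resolvent_bound_orbit\<close>).

  This inequality is used twice (\<open>bounded_orbit_contraction\<close>). With the large value
  \<open>k = \<alpha> + 1\<close> the right-hand side is controlled by the growth bound on \<open>a\<close>, and \<open>a \<le> C a(t0)\<close>
  follows with a constant \<open>C\<close> independent of the orbit. With that in hand, a small \<open>k = 1/L\<close>
  makes the right-hand side at most \<open>2C a(t0)/L\<close>, hence \<open>a(t0+L) \<le> a(t0)/2\<close> for large \<open>L\<close>.
  Iterating this halving gives exponential decay (\<open>contraction_imp_exponential_decay\<close>).
\<close>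

section \<open>Complex scalar multiplication\<close>

lemma bounded_bilinear_scaleC:
  "bounded_bilinear (scaleC :: complex \<Rightarrow> 'a::complex_banach \<Rightarrow> 'a)"
proof
  fix a b :: complex and x y :: 'a and r :: real
  show "(a + b) *\<^sub>C x = a *\<^sub>C x + b *\<^sub>C x" by (rule scaleC_add_left)
  show "a *\<^sub>C (x + y) = a *\<^sub>C x + a *\<^sub>C y" by (rule scaleC_add_right)
  show "(r *\<^sub>R a) *\<^sub>C x = r *\<^sub>R (a *\<^sub>C x)"
    by (simp add: scaleR_scaleC[of r "a *\<^sub>C x"] scaleC_scaleC scaleR_conv_of_real)
  show "a *\<^sub>C (r *\<^sub>R x) = r *\<^sub>R (a *\<^sub>C x)"
    by (simp add: scaleR_scaleC[where x = x] scaleR_scaleC[of r "a *\<^sub>C x"] scaleC_scaleC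
        mult.commute)
  show "\<exists>K. \<forall>(a::complex) (x::'a). norm (a *\<^sub>C x) \<le> norm a * norm x * K"
    by (intro exI[of _ 1]) (simp add: norm_scaleC)
qed

lemmas scaleC_diff_left = bounded_bilinear.diff_left[OF bounded_bilinear_scaleC]
lemmas scaleC_minus_left = bounded_bilinear.minus_left[OF bounded_bilinear_scaleC]
lemmas scaleC_zero_left = bounded_bilinear.zero_left[OF bounded_bilinear_scaleC]
lemmas scaleC_zero_right = bounded_bilinear.zero_right[OF bounded_bilinear_scaleC]
lemmas scaleC_scaleR_left = bounded_bilinear.scaleR_left[OF bounded_bilinear_scaleC]
lemmas scaleC_scaleR_right = bounded_bilinear.scaleR_right[OF bounded_bilinear_scaleC]

section \<open>Scalar profiles\<close>

text \<open>The error is uniform in \<open>s\<close>; this is what turns the pointwise derivative of a profile into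
  convergence of difference quotients in a supremum norm.\<close>

lemma taylor_remainder_backward:
  fixes f :: "real \<Rightarrow> 'a::real_normed_vector"
  assumes der: "\<And>x. (f has_vector_derivative f' x) (at x)"
    and lip: "L-lipschitz_on UNIV f'" and h: "0 \<le> h"
  shows "norm (f (s - h) - f s + h *\<^sub>R f' s) \<le> L * h\<^sup>2"
proof -
  have "norm (f (s - h) - f s - (s - h - s) *\<^sub>R f' s) \<le> norm (s - h - s) * (L * h)"
  proof (rule vector_differentiable_bound_linearization[where S = "{s - h..s}"])
    show "(f has_vector_derivative f' x) (at x within {s - h..s})" for x
      using der has_vector_derivative_at_within by blast
    show "closed_segment s (s - h) \<subseteq> {s - h..s}"
      using h by (simp add: closed_segment_eq_real_ivl)
    show "norm (f' x - f' s) \<le> L * h" if "x \<in> {s - h..s}" for x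
    proof -
      have "norm (f' x - f' s) \<le> L * \<bar>x - s\<bar>"
        using lipschitz_onD[OF lip, of x s] by (simp add: dist_norm)
      also have "\<dots> \<le> L * h"
        using that lipschitz_on_nonneg[OF lip] by (intro mult_left_mono) auto
      finally show ?thesis .
    qed
  qed (use h in auto)
  thus ?thesis using h by (simp add: power2_eq_square mult_ac)
qed

text \<open>The conditions on \<open>f\<close> and its derivative \<open>f'\<close> under which multiplying an orbit started at time
  \<open>t0\<close> by \<open>f\<close> gives an element of the domain of the generator. Both functions have to vanish at
  \<open>t0\<close>: their products with the orbit are continued by \<open>0\<close> to the left of \<open>t0\<close>.\<close>

definition cutoff_profile :: "real \<Rightarrow> (real \<Rightarrow> complex) \<Rightarrow> (real \<Rightarrow> complex) \<Rightarrow> bool" where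
  "cutoff_profile t0 f f' \<longleftrightarrow>
     (\<forall>s. (f has_vector_derivative f' s) (at s)) \<and> (\<exists>L. L-lipschitz_on UNIV f') \<and>
     (\<forall>s\<le>t0. f s = 0 \<and> f' s = 0) \<and> (f \<longlongrightarrow> 0) at_top \<and> (f' \<longlongrightarrow> 0) at_top"

lemma lipschitz_on_extend_zero:
  fixes g :: "real \<Rightarrow> 'a::real_normed_vector"
  assumes lip: "L-lipschitz_on {0..} g" and g0: "g 0 = 0"
  shows "L-lipschitz_on UNIV (\<lambda>x. if 0 \<le> x then g x else 0)"
proof (rule lipschitz_on_leI)
  show "0 \<le> L" using lip by (rule lipschitz_on_nonneg)
  fix x y :: real assume xy: "x \<le> y"
  show "dist (if 0 \<le> x then g x else 0) (if 0 \<le> y then g y else 0) \<le> L * dist x y"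
  proof (cases "0 \<le> x")
    case True
    then show ?thesis using lipschitz_onD[OF lip, of x y] xy by simp
  next
    case False
    have "norm (g y) \<le> L * (y - x)" if "0 \<le> y"
    proof -
      have "norm (g y) \<le> L * y"
        using lipschitz_onD[OF lip, of y 0] that g0 by simp
      also have "\<dots> \<le> L * (y - x)"
        using False \<open>0 \<le> L\<close> by (intro mult_left_mono) auto
      finally show ?thesis .
    qed
    then show ?thesis using False xy \<open>0 \<le> L\<close> by (auto simp: dist_norm)
  qed
qed

text \<open>A double zero at \<open>0\<close> is enough to glue a function on the half-line to the zero function with
  a derivative that stays Lipschitz.\<close>

lemma cutoff_profile_extend_zero:
  assumes der: "\<And>x. (p has_vector_derivative p' x) (at x)"
    and zero: "p 0 = 0" "p' 0 = 0"
    and lip: "L-lipschitz_on {0..} p'"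
    and lim: "(p \<longlongrightarrow> 0) at_top" "(p' \<longlongrightarrow> 0) at_top"
  shows "cutoff_profile t0 (\<lambda>s. if 0 \<le> s - t0 then p (s - t0) else 0)
           (\<lambda>s. if 0 \<le> s - t0 then p' (s - t0) else 0)"
proof -
  let ?p = "\<lambda>x. if 0 \<le> x then p x else 0" and ?p' = "\<lambda>x. if 0 \<le> x then p' x else 0"
  have der0: "(?p has_vector_derivative ?p' x) (at x)" for x
  proof -
    have "((\<lambda>x. if x \<in> {0..} then p x else 0) has_vector_derivative
        (if x \<in> {0..} then p' x else 0)) (at x within UNIV)"
    proof (rule has_vector_derivative_If_within_closures[where T = "{..0}"])
      show "(p has_vector_derivative p' x) (at x within {0..} \<union> closure {0..} \<inter> closure {..0})"
        using der has_vector_derivative_at_within by blast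
    qed (use zero in auto)
    then show ?thesis by simp
  qed
  have "((\<lambda>s. ?p (s - t0)) has_vector_derivative ?p' (s - t0)) (at s)" for s
  proof -
    have "((\<lambda>s. s - t0) has_vector_derivative 1) (at s)"
      by (auto intro!: derivative_eq_intros)
    from vector_diff_chain_at[OF this der0] show ?thesis by (simp only: o_def scaleR_one)
  qed
  moreover have "L-lipschitz_on UNIV (\<lambda>s. ?p' (s - t0))"
  proof (rule lipschitz_onI)
    show "dist (?p' (x - t0)) (?p' (y - t0)) \<le> L * dist x y" for x y
      using lipschitz_onD[OF lipschitz_on_extend_zero[OF lip zero(2)] UNIV_I UNIV_I,
          of "x - t0" "y - t0"] by (simp only: dist_norm diff_diff_eq2 diff_add_cancel)
  qed (rule lipschitz_on_nonneg[OF lip])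
  moreover have "((\<lambda>s. if 0 \<le> s - t0 then q (s - t0) else 0) \<longlongrightarrow> 0) at_top"
    if "(q \<longlongrightarrow> 0) at_top" for q :: "real \<Rightarrow> complex"
  proof -
    have "((\<lambda>s. q (s - t0)) \<longlongrightarrow> 0) at_top"
      using filterlim_compose[OF that filterlim_tendsto_add_at_top[OF tendsto_const[of "-t0"]
          filterlim_ident]] by (simp add: algebra_simps)
    then show ?thesis
      by (rule Lim_transform_eventually) (auto intro: eventually_mono[OF eventually_ge_at_top[of t0]])
  qed
  ultimately show ?thesis
    using lim zero unfolding cutoff_profile_def by auto
qed

text \<open>The square \<open>(1 - exp(-kx))\<^sup>2\<close> times \<open>exp(-\<mu>x)\<close>, multiplied out: as a sum of exponentials, it
  inherits its derivative, the Lipschitz bound and the limit at infinity from those of a single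
  exponential.\<close>

definition decaying_bump :: "real \<Rightarrow> complex \<Rightarrow> real \<Rightarrow> complex" where
  "decaying_bump k \<mu> x = exp (- \<mu> * of_real x) - 2 * exp (- (\<mu> + of_real k) * of_real x)
     + exp (- (\<mu> + 2 * of_real k) * of_real x)"

definition decaying_bump_deriv :: "real \<Rightarrow> complex \<Rightarrow> real \<Rightarrow> complex" where
  "decaying_bump_deriv k \<mu> x = - \<mu> * exp (- \<mu> * of_real x)
     + 2 * (\<mu> + of_real k) * exp (- (\<mu> + of_real k) * of_real x)
     - (\<mu> + 2 * of_real k) * exp (- (\<mu> + 2 * of_real k) * of_real x)"

lemma decaying_bump_eq:
  "decaying_bump k \<mu> x = exp (- \<mu> * of_real x) * of_real ((1 - exp (- k * x))\<^sup>2)"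
  by (simp add: decaying_bump_def power2_eq_square algebra_simps exp_of_real[symmetric]
      flip: exp_add)

lemma decaying_bump_deriv_eq:
  "decaying_bump_deriv k \<mu> x = - \<mu> * decaying_bump k \<mu> x
     + exp (- \<mu> * of_real x) * of_real (2 * k * exp (- k * x) * (1 - exp (- k * x)))"
  by (simp add: decaying_bump_def decaying_bump_deriv_def algebra_simps exp_of_real[symmetric]
      flip: exp_add)

lemma cexp_vector_derivative:
  "((\<lambda>x. exp (- \<mu> * of_real x)) has_vector_derivative - \<mu> * exp (- \<mu> * of_real x)) (at x)"
  for \<mu> :: complex and x :: real
  by (rule has_vector_derivative_real_field) (auto intro!: derivative_eq_intros)

lemma cexp_lipschitz:
  fixes \<mu> :: complex
  assumes "0 \<le> Re \<mu>"
  shows "(cmod \<mu>)-lipschitz_on {0..} (\<lambda>x. exp (- \<mu> * of_real x))"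
proof (rule lipschitz_onI)
  fix x y :: real assume xy: "x \<in> {0..}" "y \<in> {0..}"
  have "norm (exp (- \<mu> * of_real x) - exp (- \<mu> * of_real y)) \<le> cmod \<mu> * norm (x - y)"
  proof (rule differentiable_bound[where f' = "\<lambda>x h. h *\<^sub>R (- \<mu> * exp (- \<mu> * of_real x))"
        and S = "{0..}"])
    show "((\<lambda>x. exp (- \<mu> * of_real x)) has_derivative
        (\<lambda>h. h *\<^sub>R (- \<mu> * exp (- \<mu> * of_real z)))) (at z within {0..})" for z :: real
      using cexp_vector_derivative[of \<mu> z] has_derivative_at_withinI
      unfolding has_vector_derivative_def by blast
    show "onorm (\<lambda>h. h *\<^sub>R (- \<mu> * exp (- \<mu> * of_real z))) \<le> cmod \<mu>" if "z \<in> {0..}" for z :: real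
    proof (rule onorm_le)
      fix h :: real
      have "\<bar>h\<bar> * (cmod \<mu> * exp (- (Re \<mu> * z))) \<le> \<bar>h\<bar> * (cmod \<mu> * 1)"
        using assms that by (intro mult_left_mono) auto
      then show "norm (h *\<^sub>R (- \<mu> * exp (- \<mu> * of_real z))) \<le> cmod \<mu> * norm h"
        by (simp add: norm_mult mult_ac)
    qed
  qed (use xy in auto)
  then show "dist (exp (- \<mu> * of_real x)) (exp (- \<mu> * of_real y)) \<le> cmod \<mu> * dist x y"
    by (simp add: dist_norm)
qed simp

lemma lipschitz_on_mult_left_complex:
  fixes f :: "'b::metric_space \<Rightarrow> complex"
  assumes "L-lipschitz_on X f"
  shows "(cmod a * L)-lipschitz_on X (\<lambda>x. a * f x)"
proof (rule lipschitz_onI)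
  fix x y assume "x \<in> X" "y \<in> X"
  then have "cmod a * dist (f x) (f y) \<le> cmod a * (L * dist x y)"
    using lipschitz_onD[OF assms] by (intro mult_left_mono) auto
  then show "dist (a * f x) (a * f y) \<le> cmod a * L * dist x y"
    by (simp add: dist_norm norm_mult mult_ac flip: right_diff_distrib)
qed (use lipschitz_on_nonneg[OF assms] in simp)

lemma cexp_tendsto_0:
  fixes \<mu> :: complex
  assumes "0 < Re \<mu>"
  shows "((\<lambda>x. exp (- \<mu> * of_real x)) \<longlongrightarrow> 0) at_top"
proof (rule tendsto_norm_zero_cancel)
  have "((\<lambda>x. exp (- Re \<mu> * x)) \<longlongrightarrow> 0) at_top"
    by (intro filterlim_compose[OF exp_at_bot] filterlim_tendsto_neg_mult_at_bot[OF tendsto_const]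
        filterlim_ident) (use assms in auto)
  then show "((\<lambda>x. norm (exp (- \<mu> * of_real x))) \<longlongrightarrow> 0) at_top" by simp
qed

lemma cutoff_profile_decaying_bump:
  assumes k: "0 < k" and \<mu>: "0 < Re \<mu>"
  shows "cutoff_profile t0 (\<lambda>s. if 0 \<le> s - t0 then decaying_bump k \<mu> (s - t0) else 0)
           (\<lambda>s. if 0 \<le> s - t0 then decaying_bump_deriv k \<mu> (s - t0) else 0)"
proof (rule cutoff_profile_extend_zero)
  show "(decaying_bump k \<mu> has_vector_derivative decaying_bump_deriv k \<mu> x) (at x)" for x
    unfolding decaying_bump_def[abs_def] decaying_bump_deriv_def
    by (rule derivative_eq_intros cexp_vector_derivative refl)+ (simp add: algebra_simps)
  show "decaying_bump k \<mu> 0 = 0" "decaying_bump_deriv k \<mu> 0 = 0"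
    by (simp_all add: decaying_bump_eq decaying_bump_deriv_eq)
  show "(cmod (- \<mu>) * cmod \<mu> + cmod (2 * (\<mu> + of_real k)) * cmod (\<mu> + of_real k)
      + cmod (\<mu> + 2 * of_real k) * cmod (\<mu> + 2 * of_real k))-lipschitz_on {0..}
      (decaying_bump_deriv k \<mu>)"
    unfolding decaying_bump_deriv_def[abs_def]
    by (intro lipschitz_on_add lipschitz_on_diff lipschitz_on_mult_left_complex cexp_lipschitz)
      (use k \<mu> in auto)
  have lims: "((\<lambda>x. exp (- \<mu> * of_real x)) \<longlongrightarrow> 0) at_top"
    "((\<lambda>x. exp (- (\<mu> + of_real k) * of_real x)) \<longlongrightarrow> 0) at_top"
    "((\<lambda>x. exp (- (\<mu> + 2 * of_real k) * of_real x)) \<longlongrightarrow> 0) at_top"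
    using k \<mu> by (intro cexp_tendsto_0; simp)+
  show "(decaying_bump k \<mu> \<longlongrightarrow> 0) at_top"
    unfolding decaying_bump_def[abs_def]
    using tendsto_add[OF tendsto_diff[OF lims(1) tendsto_mult_right_zero[OF lims(2)]] lims(3)]
    by (simp only: diff_zero add_0_left)
  show "(decaying_bump_deriv k \<mu> \<longlongrightarrow> 0) at_top"
    unfolding decaying_bump_deriv_def[abs_def]
    using tendsto_diff[OF tendsto_add[OF tendsto_mult_right_zero[OF lims(1)]
          tendsto_mult_right_zero[OF lims(2)]] tendsto_mult_right_zero[OF lims(3)]]
    by (simp only: diff_zero add_0_left)
qed

lemma cmod_decaying_bump:
  "cmod (decaying_bump k \<mu> x) = exp (- Re \<mu> * x) * (1 - exp (- k * x))\<^sup>2"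
  by (simp only: decaying_bump_eq norm_mult norm_of_real norm_exp_eq_Re) simp

text \<open>The frequency \<open>\<omega>\<close> cancels. What remains are the slow damping \<open>\<eta>\<close> and the derivative of
  \<open>(1 - exp(-kx))\<^sup>2\<close>; the latter decays like \<open>exp(-kx)\<close>, and this decay is what absorbs the growth of an
  orbit.\<close>

lemma cmod_decaying_bump_shifted_deriv_le:
  assumes k: "0 < k" and \<eta>: "0 < \<eta>" and x: "0 \<le> x"
  shows "cmod (\<i> * of_real \<omega> * decaying_bump k (Complex \<eta> \<omega>) x
           + decaying_bump_deriv k (Complex \<eta> \<omega>) x) \<le> \<eta> + 2 * k * exp (- k * x)"
proof -
  let ?\<mu> = "Complex \<eta> \<omega>"
  have e: "0 \<le> 1 - exp (- k * x)" "1 - exp (- k * x) \<le> 1" "exp (- \<eta> * x) \<le> 1"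
    using assms by auto
  have ce: "cmod (1 - complex_of_real (exp (- (k * x)))) = 1 - exp (- (k * x))"
    using e(1) norm_of_real[of "1 - exp (- (k * x))", where 'a = complex] by simp
  have "\<i> * of_real \<omega> * decaying_bump k ?\<mu> x + decaying_bump_deriv k ?\<mu> x
      = - of_real \<eta> * decaying_bump k ?\<mu> x
        + exp (- ?\<mu> * of_real x) * of_real (2 * k * exp (- k * x) * (1 - exp (- k * x)))"
    unfolding decaying_bump_deriv_eq by (simp add: Complex_eq algebra_simps)
  also have "cmod \<dots> \<le> \<eta> * cmod (decaying_bump k ?\<mu> x)
      + exp (- \<eta> * x) * (2 * k * exp (- k * x) * (1 - exp (- k * x)))"
    by (rule order_trans[OF norm_triangle_ineq])
      (use assms e in \<open>simp add: norm_mult abs_mult ce\<close>)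
  also have "\<dots> \<le> \<eta> * 1 + 1 * (2 * k * exp (- k * x) * 1)"
  proof (intro add_mono mult_left_mono mult_mono)
    show "cmod (decaying_bump k ?\<mu> x) \<le> 1"
      unfolding cmod_decaying_bump using e by (intro mult_le_one power_le_one) auto
  qed (use assms e in auto)
  finally show ?thesis by simp
qed

section \<open>Lyapunov norms\<close>

text \<open>The value of \<open>adm_phi\<close> at a function depends on the function only through its value at
  time \<open>t\<close>; this is the resulting norm on the state space.\<close>

definition lyapunov_norm ::
  "(real \<Rightarrow> real \<Rightarrow> 'a::complex_banach \<Rightarrow> 'a) \<Rightarrow> real \<Rightarrow> real \<Rightarrow> 'a \<Rightarrow> real" where
  "lyapunov_norm U \<alpha> t x = (SUP \<tau>\<in>{t..}. exp (- \<alpha> * (\<tau> - t)) * norm (U \<tau> t x))"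

lemma adm_phi_eq_lyapunov_norm: "adm_phi U \<alpha> t u = lyapunov_norm U \<alpha> t (u t)"
  by (simp add: adm_phi_def lyapunov_norm_def)

locale exp_bounded_evolution =
  fixes U :: "real \<Rightarrow> real \<Rightarrow> 'a::complex_banach \<Rightarrow> 'a" and \<alpha> :: real and M :: "real \<Rightarrow> real"
  assumes evol: "evolution_family U"
    and M_cont: "continuous_on {0..} M"
    and M_pos: "0 \<le> s \<Longrightarrow> 0 < M s"
    and onorm_le: "0 \<le> s \<Longrightarrow> s \<le> t \<Longrightarrow> onorm (U t s) \<le> M s * exp (\<alpha> * (t - s))"
begin

abbreviation lnorm :: "real \<Rightarrow> 'a \<Rightarrow> real" where "lnorm \<equiv> lyapunov_norm U \<alpha>"

lemma bounded_linear_U: "0 \<le> s \<Longrightarrow> s \<le> t \<Longrightarrow> bounded_linear (U t s)"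
  using evol by (auto simp: evolution_family_def bounded_clinear_def)

lemma U_scaleC: "0 \<le> s \<Longrightarrow> s \<le> t \<Longrightarrow> U t s (a *\<^sub>C x) = a *\<^sub>C U t s x"
  using evol by (auto simp: evolution_family_def bounded_clinear_def)

lemma U_refl: "0 \<le> t \<Longrightarrow> U t t x = x"
  using evol by (auto simp: evolution_family_def)

lemma U_comp:
  assumes "0 \<le> s" "s \<le> \<tau>" "\<tau> \<le> t"
  shows "U t \<tau> (U \<tau> s x) = U t s x"
proof -
  have "U t \<tau> \<circ> U \<tau> s = U t s" using evol assms unfolding evolution_family_def by blast
  from fun_cong[OF this, of x] show ?thesis by simp
qed

lemma continuous_on_orbit:
  assumes "0 \<le> t0"
  shows "continuous_on {t0..} (\<lambda>t. U t t0 x)"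
proof -
  have "continuous_on {(t, s). 0 \<le> s \<and> s \<le> t} (\<lambda>(t, s). U t s x)"
    using evol by (auto simp: evolution_family_def)
  then have "continuous_on {t0..} (\<lambda>t. (\<lambda>(t, s). U t s x) (t, t0))"
    by (rule continuous_on_compose2) (use assms in \<open>auto intro!: continuous_intros\<close>)
  thus ?thesis by simp
qed

lemma norm_U_le:
  assumes "0 \<le> s" "s \<le> t"
  shows "norm (U t s x) \<le> M s * exp (\<alpha> * (t - s)) * norm x"
  using onorm[OF bounded_linear_U[OF assms], of x] onorm_le[OF assms]
  by (meson mult_right_mono norm_ge_zero order_trans)

lemma weighted_orbit_le:
  assumes "0 \<le> t" "t \<le> \<tau>"
  shows "exp (- \<alpha> * (\<tau> - t)) * norm (U \<tau> t x) \<le> M t * norm x"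
proof -
  have "exp (- \<alpha> * (\<tau> - t)) * norm (U \<tau> t x)
      \<le> exp (- \<alpha> * (\<tau> - t)) * (M t * exp (\<alpha> * (\<tau> - t)) * norm x)"
    by (intro mult_left_mono norm_U_le assms) auto
  also have "\<dots> = (exp (- \<alpha> * (\<tau> - t)) * exp (\<alpha> * (\<tau> - t))) * (M t * norm x)"
    by (simp only: mult_ac)
  also have "\<dots> = M t * norm x" by (simp flip: exp_add)
  finally show ?thesis .
qed

lemma weighted_orbit_le_lnorm:
  assumes "0 \<le> t" "t \<le> \<tau>"
  shows "exp (- \<alpha> * (\<tau> - t)) * norm (U \<tau> t x) \<le> lnorm t x"
  unfolding lyapunov_norm_def
proof (rule cSUP_upper)
  show "bdd_above ((\<lambda>\<tau>. exp (- \<alpha> * (\<tau> - t)) * norm (U \<tau> t x)) ` {t..})"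
    using weighted_orbit_le[OF assms(1)] by (intro bdd_aboveI2) auto
qed (use assms in auto)

lemma lnorm_leI:
  assumes "\<And>\<tau>. t \<le> \<tau> \<Longrightarrow> exp (- \<alpha> * (\<tau> - t)) * norm (U \<tau> t x) \<le> B"
  shows "lnorm t x \<le> B"
  unfolding lyapunov_norm_def using assms by (intro cSUP_least) auto

lemma norm_le_lnorm: "0 \<le> t \<Longrightarrow> norm x \<le> lnorm t x"
  using weighted_orbit_le_lnorm[of t t x] by (simp add: U_refl)

lemma lnorm_nonneg: "0 \<le> t \<Longrightarrow> 0 \<le> lnorm t x"
  using norm_le_lnorm norm_ge_zero order_trans by blast

lemma lnorm_le: "0 \<le> t \<Longrightarrow> lnorm t x \<le> M t * norm x"
  by (intro lnorm_leI weighted_orbit_le)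

lemma lnorm_zero: "0 \<le> t \<Longrightarrow> lnorm t 0 = 0"
  using lnorm_le[of t 0] lnorm_nonneg[of t 0] by simp

lemma lnorm_add:
  assumes "0 \<le> t"
  shows "lnorm t (x + y) \<le> lnorm t x + lnorm t y"
proof (rule lnorm_leI)
  fix \<tau> assume \<tau>: "t \<le> \<tau>"
  have "norm (U \<tau> t (x + y)) \<le> norm (U \<tau> t x) + norm (U \<tau> t y)"
    by (simp add: linear_add[OF bounded_linear.linear[OF bounded_linear_U]] assms \<tau>
        norm_triangle_ineq)
  then have "exp (- \<alpha> * (\<tau> - t)) * norm (U \<tau> t (x + y))
      \<le> exp (- \<alpha> * (\<tau> - t)) * (norm (U \<tau> t x) + norm (U \<tau> t y))"
    by (intro mult_left_mono) auto
  also have "\<dots> \<le> lnorm t x + lnorm t y"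
    using weighted_orbit_le_lnorm[OF assms \<tau>, of x] weighted_orbit_le_lnorm[OF assms \<tau>, of y]
    by (simp add: distrib_left)
  finally show "exp (- \<alpha> * (\<tau> - t)) * norm (U \<tau> t (x + y)) \<le> lnorm t x + lnorm t y" .
qed

lemma lnorm_scaleC_le:
  assumes "0 \<le> t"
  shows "lnorm t (a *\<^sub>C x) \<le> cmod a * lnorm t x"
proof (rule lnorm_leI)
  fix \<tau> assume \<tau>: "t \<le> \<tau>"
  have "exp (- \<alpha> * (\<tau> - t)) * norm (U \<tau> t (a *\<^sub>C x))
      = cmod a * (exp (- \<alpha> * (\<tau> - t)) * norm (U \<tau> t x))"
    by (simp add: U_scaleC assms \<tau> norm_scaleC)
  also have "\<dots> \<le> cmod a * lnorm t x"
    by (intro mult_left_mono weighted_orbit_le_lnorm assms \<tau>) auto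
  finally show "exp (- \<alpha> * (\<tau> - t)) * norm (U \<tau> t (a *\<^sub>C x)) \<le> cmod a * lnorm t x" .
qed

lemma lnorm_scaleC:
  assumes "0 \<le> t"
  shows "lnorm t (a *\<^sub>C x) = cmod a * lnorm t x"
proof (cases "a = 0")
  case True
  then show ?thesis
    using lnorm_zero[OF assms] by (simp add: bounded_bilinear.zero_left[OF bounded_bilinear_scaleC])
next
  case False
  have "x = inverse a *\<^sub>C (a *\<^sub>C x)"
    using False scaleR_scaleC[of 1 x] by (simp add: scaleC_scaleC)
  then have "lnorm t x \<le> cmod (inverse a) * lnorm t (a *\<^sub>C x)"
    using lnorm_scaleC_le[OF assms] by metis
  then have "cmod a * lnorm t x \<le> lnorm t (a *\<^sub>C x)"
    using False by (simp add: norm_inverse norm_divide field_simps)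
  then show ?thesis using lnorm_scaleC_le[OF assms, of a x] by linarith
qed

lemma lnorm_scaleR: "0 \<le> t \<Longrightarrow> lnorm t (r *\<^sub>R x) = \<bar>r\<bar> * lnorm t x"
  by (simp add: scaleR_scaleC lnorm_scaleC)

lemma lnorm_diff: "0 \<le> t \<Longrightarrow> lnorm t (x - y) \<le> lnorm t x + lnorm t y"
  using lnorm_add[of t x "(-1) *\<^sub>R y"] lnorm_scaleR[of t "-1" y] by simp

text \<open>In the Lyapunov norms the growth bound holds with constant \<open>1\<close>, uniformly in the starting
  time: a supremum over \<open>\<tau> \<ge> s\<close> is replaced by one over the smaller range \<open>\<tau> \<ge> t\<close>.\<close>

lemma lnorm_U_le:
  assumes "0 \<le> s" "s \<le> t"
  shows "lnorm t (U t s x) \<le> exp (\<alpha> * (t - s)) * lnorm s x"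
proof (rule lnorm_leI)
  fix \<tau> assume \<tau>: "t \<le> \<tau>"
  have "exp (- \<alpha> * (\<tau> - t)) * norm (U \<tau> t (U t s x))
      = exp (\<alpha> * (t - s)) * (exp (- \<alpha> * (\<tau> - s)) * norm (U \<tau> s x))"
    using assms \<tau> by (simp add: U_comp algebra_simps flip: exp_add)
  also have "\<dots> \<le> exp (\<alpha> * (t - s)) * lnorm s x"
    using assms \<tau> by (intro mult_left_mono weighted_orbit_le_lnorm) auto
  finally show "exp (- \<alpha> * (\<tau> - t)) * norm (U \<tau> t (U t s x))
      \<le> exp (\<alpha> * (t - s)) * lnorm s x" .
qed

section \<open>The generator\<close>

lemma adm_norm_leI:
  assumes "\<And>t. 0 \<le> t \<Longrightarrow> lnorm t (u t) \<le> B"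
  shows "adm_norm U \<alpha> u \<le> B"
  unfolding adm_norm_def adm_phi_eq_lyapunov_norm using assms by (intro cSUP_least) auto

lemma lnorm_le_adm_norm:
  assumes "\<And>t. 0 \<le> t \<Longrightarrow> lnorm t (u t) \<le> B" and "0 \<le> t"
  shows "lnorm t (u t) \<le> adm_norm U \<alpha> u"
  unfolding adm_norm_def adm_phi_eq_lyapunov_norm
  using assms by (intro cSUP_upper bdd_aboveI2[of _ _ B]) auto

text \<open>Boundedness holds near infinity because of the limit condition, and on a compact interval
  because \<open>M\<close> and \<open>u\<close> are continuous.\<close>

lemma adm_space_lnorm_bounded:
  assumes "u \<in> adm_space U \<alpha>"
  obtains B where "\<And>t. 0 \<le> t \<Longrightarrow> lnorm t (u t) \<le> B"
proof -
  have cont: "continuous_on {0..} u" and lim: "((\<lambda>t. lnorm t (u t)) \<longlongrightarrow> 0) at_top"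
    using assms by (auto simp: adm_space_def adm_phi_eq_lyapunov_norm)
  obtain T where T: "\<And>t. T \<le> t \<Longrightarrow> lnorm t (u t) < 1"
    using order_tendstoD(2)[OF lim zero_less_one] by (auto simp: eventually_at_top_linorder)
  have "continuous_on {0..T} (\<lambda>t. M t * norm (u t))"
    by (intro continuous_intros continuous_on_subset[OF M_cont] continuous_on_subset[OF cont]) auto
  then have "bounded ((\<lambda>t. M t * norm (u t)) ` {0..T})"
    by (intro compact_imp_bounded compact_continuous_image) auto
  then obtain B where "\<forall>y\<in>(\<lambda>t. M t * norm (u t)) ` {0..T}. norm y \<le> B"
    unfolding bounded_iff by blast
  then have B: "\<bar>M t * norm (u t)\<bar> \<le> B" if "t \<in> {0..T}" for t
    using that by simp
  have "lnorm t (u t) \<le> max 1 B" if "0 \<le> t" for t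
  proof (cases "t \<le> T")
    case True
    then show ?thesis using B[of t] lnorm_le[OF that, of "u t"] that by auto
  next
    case False
    then show ?thesis using T[of t] by auto
  qed
  then show thesis by (rule that)
qed

text \<open>Convergence in the norm of the space dominates pointwise convergence, and a pointwise limit
  is unique. The boundedness estimates guarantee that the suprema in the norms of the difference
  quotients are genuine upper bounds.\<close>

lemma generator_value_unique:
  assumes u: "u \<in> adm_space U \<alpha>"
    and v: "is_gen_value U \<alpha> u v" and w: "is_gen_value U \<alpha> u w"
  shows "v = w"
proof
  fix s :: real
  let ?q = "\<lambda>h y s. (1 / h) *\<^sub>R (evol_semigroup U h u s - u s) - y s"
  obtain Bu where Bu: "\<And>t. 0 \<le> t \<Longrightarrow> lnorm t (u t) \<le> Bu"
    using adm_space_lnorm_bounded[OF u] by blast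
  have Bu0: "0 \<le> Bu" using Bu[of 0] lnorm_nonneg[of 0 "u 0"] by linarith
  have le: "norm (?q h y s) \<le> adm_norm U \<alpha> (?q h y)"
    if h: "0 < h" and s: "0 \<le> s" and y: "y \<in> adm_space U \<alpha>" for h y
  proof -
    obtain By where By: "\<And>t. 0 \<le> t \<Longrightarrow> lnorm t (y t) \<le> By"
      using adm_space_lnorm_bounded[OF y] by blast
    have T: "lnorm t (evol_semigroup U h u t) \<le> exp (\<alpha> * h) * Bu" if t: "0 \<le> t" for t
    proof (cases "h < t")
      case True
      have "lnorm t (U t (t - h) (u (t - h))) \<le> exp (\<alpha> * (t - (t - h))) * lnorm (t - h) (u (t - h))"
        using True h by (intro lnorm_U_le) auto
      also have "\<dots> \<le> exp (\<alpha> * h) * Bu"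
        using Bu[of "t - h"] True by (auto intro!: mult_left_mono)
      finally show ?thesis using True by (simp add: evol_semigroup_def)
    next
      case False
      then show ?thesis using Bu0 lnorm_zero[OF t] by (simp add: evol_semigroup_def)
    qed
    have "lnorm t (?q h y t) \<le> (1 / h) * (exp (\<alpha> * h) * Bu + Bu) + By" if t: "0 \<le> t" for t
    proof -
      have "lnorm t (?q h y t) \<le> (1 / h) * lnorm t (evol_semigroup U h u t - u t) + lnorm t (y t)"
        using lnorm_diff[OF t, of "(1 / h) *\<^sub>R (evol_semigroup U h u t - u t)" "y t"] h
        by (simp add: lnorm_scaleR t)
      also have "\<dots> \<le> (1 / h) * (exp (\<alpha> * h) * Bu + Bu) + By"
        using lnorm_diff[OF t, of "evol_semigroup U h u t" "u t"] T[OF t] Bu[OF t] By[OF t] h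
        by (intro add_mono mult_left_mono) auto
      finally show ?thesis .
    qed
    from lnorm_le_adm_norm[OF this s] show ?thesis
      using norm_le_lnorm[OF s, of "?q h y s"] by linarith
  qed
  have vs: "v \<in> adm_space U \<alpha>" and ws: "w \<in> adm_space U \<alpha>"
    and vl: "((\<lambda>h. adm_norm U \<alpha> (?q h v)) \<longlongrightarrow> 0) (at_right 0)"
    and wl: "((\<lambda>h. adm_norm U \<alpha> (?q h w)) \<longlongrightarrow> 0) (at_right 0)"
    using v w by (auto simp: is_gen_value_def)
  show "v s = w s"
  proof (cases "0 \<le> s")
    case True
    have "norm (v s - w s) \<le> 0"
    proof (rule tendsto_le[OF trivial_limit_at_right_real _ tendsto_const])
      show "((\<lambda>h. adm_norm U \<alpha> (?q h v) + adm_norm U \<alpha> (?q h w)) \<longlongrightarrow> 0) (at_right 0)"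
        using tendsto_add[OF vl wl] by simp
      show "\<forall>\<^sub>F h in at_right 0.
          norm (v s - w s) \<le> adm_norm U \<alpha> (?q h v) + adm_norm U \<alpha> (?q h w)"
      proof (rule eventually_mono[OF eventually_at_right_less])
        fix h :: real assume h: "0 < h"
        have "norm (v s - w s) = norm (?q h w s - ?q h v s)" by simp
        also have "\<dots> \<le> norm (?q h w s) + norm (?q h v s)" by (rule norm_triangle_ineq4)
        finally show "norm (v s - w s) \<le> adm_norm U \<alpha> (?q h v) + adm_norm U \<alpha> (?q h w)"
          using le[OF h True vs] le[OF h True ws] by linarith
      qed
    qed
    then show ?thesis by simp
  next
    case False
    then show ?thesis using vs ws by (simp add: adm_space_def)
  qed
qed

lemma evol_generator_eqI:
  assumes "u \<in> adm_space U \<alpha>" "is_gen_value U \<alpha> u v"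
  shows "evol_generator U \<alpha> u = v"
  unfolding evol_generator_def
  using assms(2) generator_value_unique[OF assms(1) _ assms(2)] by (rule the_equality)

text \<open>The value \<open>0\<close> before time \<open>t0\<close> reduces every estimate to times \<open>s \<ge> t0\<close>, where \<open>U s t0\<close> has a
  meaning, whatever the scalar factor.\<close>

definition modulated_orbit :: "(real \<Rightarrow> complex) \<Rightarrow> real \<Rightarrow> 'a \<Rightarrow> real \<Rightarrow> 'a" where
  "modulated_orbit f t0 x s = (if t0 \<le> s then f s *\<^sub>C U s t0 x else 0)"

lemma lnorm_modulated_orbit:
  "0 \<le> s \<Longrightarrow> t0 \<le> s \<Longrightarrow> lnorm s (modulated_orbit f t0 x s) = cmod (f s) * lnorm s (U s t0 x)"
  by (simp add: modulated_orbit_def lnorm_scaleC)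

lemma lnorm_modulated_orbit_leI:
  assumes "0 \<le> s" "0 \<le> B" "t0 \<le> s \<Longrightarrow> cmod (f s) * lnorm s (U s t0 x) \<le> B"
  shows "lnorm s (modulated_orbit f t0 x s) \<le> B"
  using assms lnorm_modulated_orbit[of s t0 f x] lnorm_zero[of s]
  by (cases "t0 \<le> s") (auto simp: modulated_orbit_def)

lemma modulated_orbit_in_adm_space:
  assumes t0: "0 \<le> t0" and bdd: "\<And>t. t0 \<le> t \<Longrightarrow> lnorm t (U t t0 x) \<le> K"
    and f: "continuous_on {t0..} f" "f t0 = 0" "(f \<longlongrightarrow> 0) at_top"
  shows "modulated_orbit f t0 x \<in> adm_space U \<alpha>"
proof -
  have K: "0 \<le> K" by (rule order_trans[OF lnorm_nonneg[OF t0] bdd]) simp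
  have "continuous_on ({t0..} \<union> {..t0}) (modulated_orbit f t0 x)"
    unfolding modulated_orbit_def[abs_def]
  proof (rule continuous_on_cases)
    show "continuous_on {t0..} (\<lambda>s. f s *\<^sub>C U s t0 x)"
      by (intro bounded_bilinear.continuous_on[OF bounded_bilinear_scaleC] f
          continuous_on_orbit t0)
  qed (use f(2) in \<open>auto simp: scaleC_zero_left\<close>)
  then have "continuous_on {0..} (modulated_orbit f t0 x)"
    by (rule continuous_on_subset) auto
  moreover have "((\<lambda>t. lnorm t (modulated_orbit f t0 x t)) \<longlongrightarrow> 0) at_top"
  proof (rule tendsto_sandwich[OF _ _ tendsto_const])
    show "((\<lambda>t. cmod (f t) * K) \<longlongrightarrow> 0) at_top"
      using tendsto_mult_left_zero[OF tendsto_norm_zero[OF f(3)]] .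
    show "\<forall>\<^sub>F t in at_top. 0 \<le> lnorm t (modulated_orbit f t0 x t)"
      using eventually_ge_at_top[of 0] by eventually_elim (rule lnorm_nonneg)
    show "\<forall>\<^sub>F t in at_top. lnorm t (modulated_orbit f t0 x t) \<le> cmod (f t) * K"
      using eventually_ge_at_top[of 0]
      by eventually_elim
        (intro lnorm_modulated_orbit_leI mult_left_mono mult_nonneg_nonneg bdd K; simp)
  qed
  moreover have "modulated_orbit f t0 x s = 0" if "s < 0" for s
    using that t0 by (simp add: modulated_orbit_def)
  moreover have "modulated_orbit f t0 x 0 = 0"
    using t0 f(2) by (cases "t0 = 0") (auto simp: modulated_orbit_def scaleC_zero_left)
  ultimately show ?thesis by (simp add: adm_space_def adm_phi_eq_lyapunov_norm)
qed

text \<open>The orbit is invariant under the evolution family, so only the scalar factor is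
  translated.\<close>

lemma evol_semigroup_modulated_orbit:
  assumes t0: "0 \<le> t0" and f: "\<And>s. s \<le> t0 \<Longrightarrow> f s = 0" and h: "0 < h"
  shows "evol_semigroup U h (modulated_orbit f t0 x) s = modulated_orbit (\<lambda>s. f (s - h)) t0 x s"
proof (cases "h < s \<and> t0 \<le> s - h")
  case True
  then show ?thesis
    using t0 h by (simp add: evol_semigroup_def modulated_orbit_def U_scaleC U_comp)
next
  case False
  have "U s (s - h) 0 = 0" if "h < s"
    using linear_0[OF bounded_linear.linear[OF bounded_linear_U[of "s - h" s]]] that h by simp
  then show ?thesis
    using False t0 h f[of "s - h"]
    by (auto simp: evol_semigroup_def modulated_orbit_def scaleC_zero_left)
qed

lemma modulated_orbit_generator:
  assumes t0: "0 \<le> t0" and bdd: "\<And>t. t0 \<le> t \<Longrightarrow> lnorm t (U t t0 x) \<le> K"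
    and f: "cutoff_profile t0 f f'"
  shows "is_gen_value U \<alpha> (modulated_orbit f t0 x) (modulated_orbit (\<lambda>s. - f' s) t0 x)"
proof -
  obtain L where lip: "L-lipschitz_on UNIV f'"
    and der: "\<And>s. (f has_vector_derivative f' s) (at s)"
    and zero: "\<And>s. s \<le> t0 \<Longrightarrow> f s = 0" "\<And>s. s \<le> t0 \<Longrightarrow> f' s = 0"
    and lim: "(f' \<longlongrightarrow> 0) at_top"
    using f by (auto simp: cutoff_profile_def)
  have K: "0 \<le> K" by (rule order_trans[OF lnorm_nonneg[OF t0] bdd]) simp
  have L: "0 \<le> L" using lip by (rule lipschitz_on_nonneg)
  have "modulated_orbit (\<lambda>s. - f' s) t0 x \<in> adm_space U \<alpha>"
  proof (rule modulated_orbit_in_adm_space[OF t0 bdd])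
    show "continuous_on {t0..} (\<lambda>s. - f' s)"
      by (intro continuous_on_minus continuous_on_subset[OF lipschitz_on_continuous_on[OF lip]]) simp
    show "((\<lambda>s. - f' s) \<longlongrightarrow> 0) at_top" using tendsto_minus[OF lim] by simp
  qed (use zero in auto)
  moreover have "((\<lambda>h. adm_norm U \<alpha> (\<lambda>s. (1 / h) *\<^sub>R (evol_semigroup U h (modulated_orbit f t0 x) s
      - modulated_orbit f t0 x s) - modulated_orbit (\<lambda>s. - f' s) t0 x s)) \<longlongrightarrow> 0) (at_right 0)"
    (is "((\<lambda>h. adm_norm U \<alpha> (?w h)) \<longlongrightarrow> 0) _")
  proof (rule tendsto_sandwich[OF _ _ tendsto_const])
    have w: "lnorm s (?w h s) \<le> L * h * K" if h: "0 < h" and s: "0 \<le> s" for h s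
    proof -
      have eq: "?w h = modulated_orbit (\<lambda>s. (1 / h) *\<^sub>R (f (s - h) - f s) + f' s) t0 x"
        by (auto simp: fun_eq_iff evol_semigroup_modulated_orbit[where f = f, OF t0 _ h] zero(1)
            modulated_orbit_def scaleC_add_left scaleC_diff_left
            scaleC_minus_left scaleC_scaleR_left)
      have le: "cmod ((1 / h) *\<^sub>R (f (s - h) - f s) + f' s) \<le> L * h"
      proof -
        have "(1 / h) *\<^sub>R (f (s - h) - f s) + f' s = (1 / h) *\<^sub>R (f (s - h) - f s + h *\<^sub>R f' s)"
          using h by (simp add: scaleR_add_right)
        also have "cmod \<dots> \<le> (1 / h) * (L * h\<^sup>2)"
          unfolding norm_scaleR using taylor_remainder_backward[OF der lip, of h s] h
          by (intro mult_mono) auto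
        finally show ?thesis using h by (simp add: power2_eq_square)
      qed
      have "lnorm s (modulated_orbit (\<lambda>s. (1 / h) *\<^sub>R (f (s - h) - f s) + f' s) t0 x s) \<le> L * h * K"
        using K L h s by (intro lnorm_modulated_orbit_leI mult_mono bdd le lnorm_nonneg) auto
      with fun_cong[OF eq, of s] show ?thesis by (simp only:)
    qed
    show "((\<lambda>h. L * h * K) \<longlongrightarrow> 0) (at_right 0)"
      by (auto intro!: tendsto_eq_intros)
    show "\<forall>\<^sub>F h in at_right 0. adm_norm U \<alpha> (?w h) \<le> L * h * K"
      by (rule eventually_mono[OF eventually_at_right_less]) (intro adm_norm_leI w)
    show "\<forall>\<^sub>F h in at_right 0. 0 \<le> adm_norm U \<alpha> (?w h)"
    proof (rule eventually_mono[OF eventually_at_right_less])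
      fix h :: real assume h: "0 < h"
      show "0 \<le> adm_norm U \<alpha> (?w h)"
        using lnorm_le_adm_norm[of "?w h" "L * h * K" 0, OF w[OF h]] lnorm_nonneg[of 0 "?w h 0"]
        by simp
    qed
  qed
  ultimately show ?thesis by (simp add: is_gen_value_def)
qed

text \<open>The lower bound \<open>c\<close> for unit vectors is transferred to \<open>u = f U(\<cdot>,t0)x\<close> by dividing the
  profile \<open>f\<close> by the norm of \<open>u\<close>.\<close>

lemma resolvent_bound_modulated_orbit:
  assumes lower: "\<And>u. u \<in> gen_domain U \<alpha> \<Longrightarrow> adm_norm U \<alpha> u = 1 \<Longrightarrow>
      c \<le> adm_norm U \<alpha> (\<lambda>s. z *\<^sub>C u s - evol_generator U \<alpha> u s)"
    and c: "0 < c"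
    and t0: "0 \<le> t0" and bdd: "\<And>t. t0 \<le> t \<Longrightarrow> lnorm t (U t t0 x) \<le> K"
    and f: "cutoff_profile t0 f f'"
    and B: "\<And>s. t0 \<le> s \<Longrightarrow> cmod (z * f s + f' s) * lnorm s (U s t0 x) \<le> B"
    and s: "t0 \<le> s"
  shows "c * (cmod (f s) * lnorm s (U s t0 x)) \<le> B"
proof -
  have prof: "modulated_orbit g t0 x \<in> adm_space U \<alpha>" if "cutoff_profile t0 g g'" for g g'
  proof (rule modulated_orbit_in_adm_space[OF t0 bdd])
    show "continuous_on {t0..} g"
      using that unfolding cutoff_profile_def
      by (blast intro: continuous_at_imp_continuous_on has_vector_derivative_continuous)
  qed (use that in \<open>auto simp: cutoff_profile_def\<close>)
  let ?u = "modulated_orbit f t0 x"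
  define n where "n = adm_norm U \<alpha> ?u"
  obtain Bu where Bu: "\<And>t. 0 \<le> t \<Longrightarrow> lnorm t (?u t) \<le> Bu"
    using adm_space_lnorm_bounded[OF prof[OF f]] by blast
  have le_n: "lnorm t (?u t) \<le> n" if "0 \<le> t" for t
    unfolding n_def using lnorm_le_adm_norm[OF Bu that] .
  have B0: "0 \<le> B"
    using B[of t0] lnorm_nonneg[OF t0, of "U t0 t0 x"] norm_ge_zero
    by (meson mult_nonneg_nonneg order_refl order_trans)
  have fs: "cmod (f s) * lnorm s (U s t0 x) \<le> n"
    using le_n[of s] lnorm_modulated_orbit[of s t0 f x] s t0 by simp
  \<comment> \<open>It remains to compare \<open>B\<close> with the norm \<open>n\<close> of the unnormalised vector.\<close>
  have "c * n \<le> B"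
  proof (cases "0 < n")
    case False
    then show ?thesis using B0 c by (smt (verit) mult_nonneg_nonpos)
  next
    case True
    define g where "g = (\<lambda>s. (1 / n) *\<^sub>R f s)"
    define g' where "g' = (\<lambda>s. (1 / n) *\<^sub>R f' s)"
    have g: "cutoff_profile t0 g g'"
      unfolding cutoff_profile_def
    proof (intro conjI allI)
      show "(g has_vector_derivative g' s) (at s)" for s
        using f unfolding g_def g'_def cutoff_profile_def
        by (auto intro!: bounded_linear.has_vector_derivative[OF bounded_linear_scaleR_right])
      show "\<exists>L. L-lipschitz_on UNIV g'"
        using f unfolding g'_def cutoff_profile_def by (auto intro: lipschitz_on_cmult)
      show "(g \<longlongrightarrow> 0) at_top" "(g' \<longlongrightarrow> 0) at_top"
        using f tendsto_scaleR[OF tendsto_const[of "1 / n"], of _ 0 at_top]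
        unfolding g_def g'_def cutoff_profile_def by auto
    qed (use f in \<open>auto simp: g_def g'_def cutoff_profile_def\<close>)
    let ?v = "modulated_orbit g t0 x"
    have v: "?v s = (1 / n) *\<^sub>R ?u s" for s
      by (simp add: modulated_orbit_def g_def scaleC_scaleR_left)
    have v_le: "lnorm s (?v s) \<le> 1" if "0 \<le> s" for s
      using le_n[OF that] True by (simp add: v lnorm_scaleR that)
    have "adm_norm U \<alpha> ?u \<le> n * adm_norm U \<alpha> ?v"
    proof (rule adm_norm_leI)
      fix s :: real assume s: "0 \<le> s"
      have "lnorm s (?u s) = n * lnorm s (?v s)"
        using True by (simp add: v lnorm_scaleR s)
      also have "\<dots> \<le> n * adm_norm U \<alpha> ?v"
        using True by (intro mult_left_mono lnorm_le_adm_norm[OF v_le s]) auto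
      finally show "lnorm s (?u s) \<le> n * adm_norm U \<alpha> ?v" .
    qed
    then have v1: "adm_norm U \<alpha> ?v = 1"
      using adm_norm_leI[of ?v 1, OF v_le] True unfolding n_def[symmetric] by simp
    have gen: "is_gen_value U \<alpha> ?v (modulated_orbit (\<lambda>s. - g' s) t0 x)"
      by (rule modulated_orbit_generator[OF t0 bdd g])
    have "c \<le> adm_norm U \<alpha> (\<lambda>s. z *\<^sub>C ?v s - modulated_orbit (\<lambda>s. - g' s) t0 x s)"
      using lower[of ?v] v1 gen prof[OF g] evol_generator_eqI[OF prof[OF g] gen]
      by (auto simp: gen_domain_def)
    also have "(\<lambda>s. z *\<^sub>C ?v s - modulated_orbit (\<lambda>s. - g' s) t0 x s)
        = modulated_orbit (\<lambda>s. (1 / n) *\<^sub>R (z * f s + f' s)) t0 x"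
      by (auto simp: fun_eq_iff modulated_orbit_def g_def g'_def scaleC_add_left scaleC_minus_left
          scaleC_scaleR_left scaleC_scaleR_right scaleC_zero_right scaleR_add_right
          simp flip: scaleC_scaleC)
    also have "adm_norm U \<alpha> \<dots> \<le> B / n"
    proof (intro adm_norm_leI lnorm_modulated_orbit_leI)
      fix s assume "t0 \<le> s"
      from B[OF this] show "cmod ((1 / n) *\<^sub>R (z * f s + f' s)) * lnorm s (U s t0 x) \<le> B / n"
        using True by (simp add: divide_right_mono)
    qed (use B0 True in auto)
    finally show ?thesis using True by (simp add: field_simps)
  qed
  then show ?thesis using fs c by (meson mult_left_mono less_imp_le order_trans)
qed

section \<open>Decay of bounded orbits\<close>

text \<open>The limit \<open>\<eta> \<longrightarrow> 0\<close> of the bound for the profiles \<open>decaying_bump k (Complex \<eta> \<omega>)\<close>. Having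
  some bound \<open>K\<close> for the orbit is what makes the contribution \<open>\<eta> K\<close> of the damping disappear.\<close>

lemma resolvent_bound_orbit:
  assumes lower: "\<And>u. u \<in> gen_domain U \<alpha> \<Longrightarrow> adm_norm U \<alpha> u = 1 \<Longrightarrow>
      c \<le> adm_norm U \<alpha> (\<lambda>s. (\<i> * of_real \<omega>) *\<^sub>C u s - evol_generator U \<alpha> u s)"
    and c: "0 < c"
    and t0: "0 \<le> t0" and bdd: "\<And>t. t0 \<le> t \<Longrightarrow> lnorm t (U t t0 x) \<le> K"
    and k: "0 < k"
    and B: "\<And>s. t0 \<le> s \<Longrightarrow> exp (- k * (s - t0)) * lnorm s (U s t0 x) \<le> B"
    and s: "t0 \<le> s"
  shows "c * (1 - exp (- k * (s - t0)))\<^sup>2 * lnorm s (U s t0 x) \<le> 2 * k * B"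
proof (rule tendsto_le[OF trivial_limit_at_right_real])
  let ?e = "(1 - exp (- k * (s - t0)))\<^sup>2" and ?a = "\<lambda>s. lnorm s (U s t0 x)"
  show "((\<lambda>\<eta>. \<eta> * K + 2 * k * B) \<longlongrightarrow> 2 * k * B) (at_right 0)"
    by (auto intro!: tendsto_eq_intros)
  show "((\<lambda>\<eta>. c * (exp (- \<eta> * (s - t0)) * ?e * ?a s)) \<longlongrightarrow> c * ?e * ?a s) (at_right 0)"
    by (auto intro!: tendsto_eq_intros)
  show "\<forall>\<^sub>F \<eta> in at_right 0. c * (exp (- \<eta> * (s - t0)) * ?e * ?a s) \<le> \<eta> * K + 2 * k * B"
  proof (rule eventually_mono[OF eventually_at_right_less])
    fix \<eta> :: real assume \<eta>: "0 < \<eta>"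
    let ?p = "\<lambda>s. if 0 \<le> s - t0 then decaying_bump k (Complex \<eta> \<omega>) (s - t0) else 0"
    let ?p' = "\<lambda>s. if 0 \<le> s - t0 then decaying_bump_deriv k (Complex \<eta> \<omega>) (s - t0) else 0"
    have "c * (cmod (?p s) * ?a s) \<le> \<eta> * K + 2 * k * B"
    proof (rule resolvent_bound_modulated_orbit[OF lower c t0 bdd _ _ s])
      show "cutoff_profile t0 ?p ?p'"
        using k \<eta> by (intro cutoff_profile_decaying_bump) auto
      fix r assume r: "t0 \<le> r"
      have a0: "0 \<le> ?a r" using t0 r by (intro lnorm_nonneg) auto
      have "cmod (\<i> * of_real \<omega> * ?p r + ?p' r) * ?a r
          \<le> (\<eta> + 2 * k * exp (- k * (r - t0))) * ?a r"
        using cmod_decaying_bump_shifted_deriv_le[OF k \<eta>, of "r - t0" \<omega>] r a0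
        by (intro mult_right_mono) auto
      also have "\<dots> = \<eta> * ?a r + 2 * k * (exp (- k * (r - t0)) * ?a r)"
        by (simp add: algebra_simps)
      also have "\<dots> \<le> \<eta> * K + 2 * k * B"
        using k \<eta> by (intro add_mono mult_left_mono bdd B r) auto
      finally show "cmod (\<i> * of_real \<omega> * ?p r + ?p' r) * ?a r \<le> \<eta> * K + 2 * k * B" .
    qed
    then show "c * (exp (- \<eta> * (s - t0)) * ?e * ?a s) \<le> \<eta> * K + 2 * k * B"
      using s by (simp add: cmod_decaying_bump mult_ac)
  qed
qed

text \<open>The length \<open>L\<close> is obtained before the starting time, the starting point and the bound \<open>K\<close>:
  this uniformity is what allows the halving to be iterated with a rate common to all bounded
  orbits.\<close>

lemma bounded_orbit_contraction:
  assumes lower: "\<And>u. u \<in> gen_domain U \<alpha> \<Longrightarrow> adm_norm U \<alpha> u = 1 \<Longrightarrow>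
      c \<le> adm_norm U \<alpha> (\<lambda>s. (\<i> * of_real \<omega>) *\<^sub>C u s - evol_generator U \<alpha> u s)"
    and c: "0 < c" and \<alpha>: "0 \<le> \<alpha>"
  obtains L where "0 < L"
    and "\<And>t0 x K. 0 \<le> t0 \<Longrightarrow> (\<And>t. t0 \<le> t \<Longrightarrow> lnorm t (U t t0 x) \<le> K) \<Longrightarrow>
      lnorm (t0 + L) (U (t0 + L) t0 x) \<le> lnorm t0 x / 2"
proof -
  \<comment> \<open>The first step works with any \<open>k > \<alpha>\<close>, so that \<open>exp(-ky)\<close> beats the growth \<open>exp(\<alpha>y)\<close>. The two
     summands of \<open>C\<close> are the bounds on \<open>[t0, t0 + 1]\<close> and beyond; \<open>L\<close> is chosen so that
     \<open>2 C / (d1 L) = 1 / 2\<close>.\<close>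
  define k where "k = \<alpha> + 1"
  define d where "d = c * (1 - exp (- k))\<^sup>2"
  define C where "C = exp \<alpha> + 2 * k / d"
  define d1 where "d1 = c * (1 - exp (- 1))\<^sup>2"
  define L where "L = 4 * C / d1"
  have k: "0 < k" using \<alpha> by (simp add: k_def)
  have d: "0 < d" "0 < d1" using c k by (simp_all add: d_def d1_def)
  have C: "0 < C" using k d by (simp add: C_def add_pos_pos)
  have L: "0 < L" using C d by (simp add: L_def)
  have "lnorm (t0 + L) (U (t0 + L) t0 x) \<le> lnorm t0 x / 2"
    if t0: "0 \<le> t0" and bdd: "\<And>t. t0 \<le> t \<Longrightarrow> lnorm t (U t t0 x) \<le> K" for t0 x K
  proof -
    let ?a = "\<lambda>t. lnorm t (U t t0 x)"
    have a0: "?a t0 = lnorm t0 x" using t0 by (simp add: U_refl)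
    have pos: "0 \<le> ?a t" if "t0 \<le> t" for t using that t0 by (intro lnorm_nonneg) auto
    have growth: "?a t \<le> exp (\<alpha> * (t - t0)) * ?a t0" if "t0 \<le> t" for t
      unfolding a0 using lnorm_U_le[OF t0 that] .
    have stable: "?a t \<le> C * ?a t0" if t: "t0 \<le> t" for t
    proof (cases "t \<le> t0 + 1")
      case True
      have "\<alpha> * (t - t0) \<le> \<alpha> * 1" using \<alpha> True by (intro mult_left_mono) auto
      then have "exp (\<alpha> * (t - t0)) \<le> C" using k d by (simp add: C_def add_increasing2)
      then show ?thesis using growth[OF t] pos[of t0] by (meson mult_right_mono order_refl order_trans)
    next
      case False
      have "c * (1 - exp (- k * (t - t0)))\<^sup>2 * ?a t \<le> 2 * k * ?a t0"
      proof (rule resolvent_bound_orbit[OF lower c t0 bdd k _ t])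
        fix s assume s: "t0 \<le> s"
        have "exp (- k * (s - t0)) * ?a s \<le> exp (- k * (s - t0)) * (exp (\<alpha> * (s - t0)) * ?a t0)"
          using growth[OF s] by (intro mult_left_mono) auto
        also have "\<dots> = exp (- (s - t0)) * ?a t0"
          by (simp add: k_def algebra_simps flip: exp_add mult.assoc)
        also have "\<dots> \<le> ?a t0" using s pos[of t0] by (intro mult_left_le_one_le) auto
        finally show "exp (- k * (s - t0)) * ?a s \<le> ?a t0" .
      qed
      moreover have "d * ?a t \<le> c * (1 - exp (- k * (t - t0)))\<^sup>2 * ?a t"
        unfolding d_def using False c k pos[OF t]
        by (intro mult_right_mono mult_left_mono power_mono) auto
      ultimately have "?a t \<le> 2 * k / d * ?a t0" using d by (simp add: field_simps)
      also have "\<dots> \<le> C * ?a t0" using pos[of t0] by (intro mult_right_mono) (auto simp: C_def)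
      finally show ?thesis .
    qed
    \<comment> \<open>The second step uses the slow profile \<open>k = 1 / L\<close>, evaluated at time \<open>t0 + L\<close>.\<close>
    have "c * (1 - exp (- (1 / L) * (t0 + L - t0)))\<^sup>2 * ?a (t0 + L) \<le> 2 * (1 / L) * (C * ?a t0)"
    proof (rule resolvent_bound_orbit[OF lower c t0 bdd])
      fix s assume s: "t0 \<le> s"
      have "exp (- (1 / L) * (s - t0)) * ?a s \<le> 1 * ?a s"
        using s L pos[OF s] by (intro mult_right_mono) auto
      then show "exp (- (1 / L) * (s - t0)) * ?a s \<le> C * ?a t0" using stable[OF s] by linarith
    qed (use L in auto)
    then have "d1 * ?a (t0 + L) \<le> 2 * (1 / L) * (C * ?a t0)" using L by (simp add: d1_def)
    then have "?a (t0 + L) \<le> ?a t0 / 2" using d C by (simp add: L_def field_simps)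
    then show ?thesis by (simp only: a0)
  qed
  with L show thesis by (rule that)
qed

text \<open>Every later point of a bounded orbit starts a bounded orbit, so the halving repeats after each
  period \<open>L\<close>; inside a period the growth bound costs at most the factor \<open>exp(\<alpha>L)\<close>, and rounding
  the elapsed time down to whole periods costs the factor \<open>2\<close>.\<close>

lemma contraction_imp_exponential_decay:
  assumes L: "0 < L" and \<alpha>: "0 \<le> \<alpha>"
    and contr: "\<And>t0 x K. 0 \<le> t0 \<Longrightarrow> (\<And>t. t0 \<le> t \<Longrightarrow> lnorm t (U t t0 x) \<le> K) \<Longrightarrow>
      lnorm (t0 + L) (U (t0 + L) t0 x) \<le> lnorm t0 x / 2"
    and t0: "0 \<le> t0" and bdd: "\<And>t. t0 \<le> t \<Longrightarrow> lnorm t (U t t0 x) \<le> K" and t: "t0 \<le> t"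
  shows "lnorm t (U t t0 x) \<le> 2 * exp (\<alpha> * L) * exp (- (ln 2 / L) * (t - t0)) * lnorm t0 x"
proof -
  let ?a = "\<lambda>t. lnorm t (U t t0 x)"
  have iter: "?a (t0 + of_nat n * L) \<le> lnorm t0 x / 2 ^ n" for n
  proof (induction n)
    case 0
    then show ?case using t0 by (simp add: U_refl)
  next
    case (Suc n)
    let ?s = "t0 + of_nat n * L"
    have s: "t0 \<le> ?s" using L by simp
    have "lnorm (?s + L) (U (?s + L) ?s (U ?s t0 x)) \<le> ?a ?s / 2"
    proof (rule contr)
      fix r assume r: "?s \<le> r"
      show "lnorm r (U r ?s (U ?s t0 x)) \<le> K"
        using bdd[of r] s r t0 by (simp add: U_comp)
    qed (use s t0 in simp)
    then have "?a (?s + L) \<le> ?a ?s / 2" using s t0 L by (simp add: U_comp)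
    also have "\<dots> \<le> lnorm t0 x / 2 ^ Suc n" using Suc.IH by simp
    finally show ?case by (simp add: algebra_simps)
  qed
  define n where "n = nat \<lfloor>(t - t0) / L\<rfloor>"
  define s where "s = t0 + of_nat n * L"
  have "real n = of_int \<lfloor>(t - t0) / L\<rfloor>" using L t by (simp add: n_def)
  then have n: "of_nat n \<le> (t - t0) / L" "(t - t0) / L < of_nat n + 1" by linarith+
  have s: "t0 \<le> s" "s \<le> t" "t \<le> s + L" using n L by (auto simp: s_def field_simps)
  have a0: "0 \<le> lnorm t0 x" using t0 by (rule lnorm_nonneg)
  have "2 powr ((t - t0) / L) \<le> 2 powr (of_nat n + 1)" using n by (intro powr_mono) auto
  also have "\<dots> = 2 * 2 ^ n" by (simp add: powr_add powr_realpow)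
  finally have "exp ((ln 2 / L) * (t - t0)) \<le> 2 * 2 ^ n" by (simp add: powr_def mult.commute)
  then have decay: "1 / 2 ^ n \<le> 2 * exp (- (ln 2 / L) * (t - t0))"
    by (simp add: exp_minus field_simps)
  have "?a t = lnorm t (U t s (U s t0 x))" using s t0 by (simp add: U_comp)
  also have "\<dots> \<le> exp (\<alpha> * (t - s)) * ?a s" using s t0 by (intro lnorm_U_le) auto
  also have "\<dots> \<le> exp (\<alpha> * L) * (lnorm t0 x * (1 / 2 ^ n))"
    using iter[of n] s \<alpha> t0 by (intro mult_mono) (auto simp: s_def intro!: mult_left_mono lnorm_nonneg)
  also have "\<dots> \<le> exp (\<alpha> * L) * (lnorm t0 x * (2 * exp (- (ln 2 / L) * (t - t0))))"
    using decay a0 by (intro mult_left_mono) auto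
  finally show ?thesis by (simp only: mult_ac)
qed

end

theorem theorem4p1:
  fixes U :: "real \<Rightarrow> real \<Rightarrow> 'a::complex_banach \<Rightarrow> 'a" and \<alpha> :: real
  assumes "evolution_family U"
    and "nonuniform_exp_bounded U"
    and "\<alpha> \<in> admissible_exponents U"
    and "approx_point_spectrum (adm_norm U \<alpha>) (gen_domain U \<alpha>) (evol_generator U \<alpha>)
           \<inter> imag_axis \<noteq> imag_axis"
  shows "\<exists>(\<nu>::real) (N :: real \<Rightarrow> real).
           \<nu> > 0 \<and> continuous_on {0..} N \<and> (\<forall>s\<ge>0. N s > 0) \<and>
           (\<forall>x0 t0. t0 \<ge> 0 \<and> bdd_above ((\<lambda>t. norm (U t t0 x0)) ` {t0..}) \<longrightarrow>
              (\<forall>t\<ge>t0. norm (U t t0 x0) \<le> N t0 * exp (- \<nu> * (t - t0)) * norm x0))"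
proof -
  obtain M where M: "continuous_on {0..} M" "\<And>s. 0 \<le> s \<Longrightarrow> 0 < M s"
    "\<And>t s. 0 \<le> s \<Longrightarrow> s \<le> t \<Longrightarrow> onorm (U t s) \<le> M s * exp (\<alpha> * (t - s))"
    using assms(3) by (auto simp: admissible_exponents_def)
  interpret exp_bounded_evolution U \<alpha> M
    using assms(1) M by unfold_locales
  show ?thesis
  proof (cases "\<alpha> < 0")
    case True
    have "norm (U t t0 x0) \<le> M t0 * exp (- (- \<alpha>) * (t - t0)) * norm x0"
      if "0 \<le> t0" "t0 \<le> t" for t t0 x0
      using norm_U_le[OF that, of x0] by simp
    then show ?thesis
      using True M by (intro exI[of _ "- \<alpha>"] exI[of _ M]) auto
  next
    case False
    then have \<alpha>: "0 \<le> \<alpha>" by simp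
    obtain \<omega> :: real where "\<i> * of_real \<omega> \<notin>
        approx_point_spectrum (adm_norm U \<alpha>) (gen_domain U \<alpha>) (evol_generator U \<alpha>)"
      using assms(4) by (auto simp: imag_axis_def)
    then obtain c where c: "0 < c" and
      "\<forall>u\<in>gen_domain U \<alpha>. adm_norm U \<alpha> u = 1 \<longrightarrow>
        \<not> adm_norm U \<alpha> (\<lambda>s. (\<i> * of_real \<omega>) *\<^sub>C u s - evol_generator U \<alpha> u s) \<le> c"
      unfolding approx_point_spectrum_def by blast
    then have lower: "\<And>u. u \<in> gen_domain U \<alpha> \<Longrightarrow> adm_norm U \<alpha> u = 1 \<Longrightarrow>
      c \<le> adm_norm U \<alpha> (\<lambda>s. (\<i> * of_real \<omega>) *\<^sub>C u s - evol_generator U \<alpha> u s)"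
      by (meson linear)
    obtain L where L: "0 < L" and contr: "\<And>t0 x K. 0 \<le> t0 \<Longrightarrow>
      (\<And>t. t0 \<le> t \<Longrightarrow> lnorm t (U t t0 x) \<le> K) \<Longrightarrow>
      lnorm (t0 + L) (U (t0 + L) t0 x) \<le> lnorm t0 x / 2"
      using bounded_orbit_contraction[OF lower c \<alpha>] by blast
    let ?N = "\<lambda>s. 2 * exp (\<alpha> * L) * M s"
    have "norm (U t t0 x) \<le> ?N t0 * exp (- (ln 2 / L) * (t - t0)) * norm x"
      if t0: "0 \<le> t0" and bdd: "bdd_above ((\<lambda>t. norm (U t t0 x)) ` {t0..})" and t: "t0 \<le> t"
      for t t0 x
    proof -
      obtain K where K: "\<And>t. t0 \<le> t \<Longrightarrow> norm (U t t0 x) \<le> K"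
        using bdd by (auto simp: bdd_above_def)
      have lK: "lnorm t (U t t0 x) \<le> K" if t: "t0 \<le> t" for t
      proof (rule lnorm_leI)
        fix \<tau> assume \<tau>: "t \<le> \<tau>"
        have "exp (- \<alpha> * (\<tau> - t)) * norm (U \<tau> t (U t t0 x)) \<le> 1 * norm (U \<tau> t0 x)"
          using \<alpha> t \<tau> t0 by (intro mult_mono) (auto simp: U_comp)
        then show "exp (- \<alpha> * (\<tau> - t)) * norm (U \<tau> t (U t t0 x)) \<le> K"
          using K[of \<tau>] t \<tau> by simp
      qed
      have "norm (U t t0 x) \<le> lnorm t (U t t0 x)" using t t0 by (intro norm_le_lnorm) simp
      also have "\<dots> \<le> 2 * exp (\<alpha> * L) * exp (- (ln 2 / L) * (t - t0)) * lnorm t0 x"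
        by (rule contraction_imp_exponential_decay[OF L \<alpha> contr t0 lK t])
      also have "\<dots> \<le> 2 * exp (\<alpha> * L) * exp (- (ln 2 / L) * (t - t0)) * (M t0 * norm x)"
        using lnorm_le[OF t0] by (intro mult_left_mono) auto
      finally show ?thesis by (simp only: mult_ac)
    qed
    moreover have "continuous_on {0..} ?N" by (intro continuous_intros M)
    moreover have "0 < ln 2 / L" using L by simp
    ultimately show ?thesis
      using M(2) by (intro exI[of _ "ln 2 / L"] exI[of _ ?N]) auto
  qed
qed

end
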